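(* Let $\alpha>1$ be an integer. The code distance of the Chamon model with $\alpha_x=\alpha_y=\alpha_z=\alpha$ is $d=2\alpha$.
   Context: Chamon model: let $\mathcal A=\mathbb Z_{2\alpha_x}\times\mathbb Z_{2\alpha_y}\times\mathbb Z_{2\alpha_z}$ and $\mathcal D=\{(x,y,z)\in\mathcal A: x+y+z \text{ even}\}$, one qubit per point of $\mathcal D$. With $e_x^{\pm}=(\pm1,0,0)$, $e_y^{\pm}=(0,\pm1,0)$, $e_z^{\pm}=(0,0,\pm1)$, for $s\in\mathcal A\setminus\mathcal D$ the stabilizer generator is $S_s=X_{s+e_x^+}X_{s+e_x^-}Y_{s+e_y^+}Y_{s+e_y^-}Z_{s+e_z^+}Z_{s+e_z^-}$ (single-qubit Paulis); $\mathcal S$ is the group they generate. The weight of a Pauli operator is the number of qubits on which it acts non-trivially. The code distance $d$ is the minimum weight of a Pauli operator on the qubits of $\mathcal D$ that commutes with every $S_s$ but is not (up to a phase) an element of $\mathcal S$. *)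

theory Defs
  imports Main
begin

text \<open>Chamon model. Points of A = Z_{2ax} x Z_{2ay} x Z_{2az} are represented by integer
  triples with coordinates in [0, 2a). Pauli operators are taken up to phase: a map from
  points to single-qubit Paulis (identity outside the qubit set D).\<close>

type_synonym pt = "int \<times> int \<times> int"

datatype pauli = PI | PX | PY | PZ

definition latA :: "nat \<Rightarrow> nat \<Rightarrow> nat \<Rightarrow> pt set" where
  "latA ax ay az = {(x, y, z). 0 \<le> x \<and> x < 2 * int ax \<and> 0 \<le> y \<and> y < 2 * int ay
                                \<and> 0 \<le> z \<and> z < 2 * int az}"

definition latD :: "nat \<Rightarrow> nat \<Rightarrow> nat \<Rightarrow> pt set" where
  "latD ax ay az = {(x, y, z). (x, y, z) \<in> latA ax ay az \<and> even (x + y + z)}"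

fun shift :: "nat \<Rightarrow> nat \<Rightarrow> nat \<Rightarrow> pt \<Rightarrow> pt \<Rightarrow> pt" where
  "shift ax ay az (x, y, z) (dx, dy, dz) =
     ((x + dx) mod (2 * int ax), (y + dy) mod (2 * int ay), (z + dz) mod (2 * int az))"

fun pmul :: "pauli \<Rightarrow> pauli \<Rightarrow> pauli" where
  "pmul PI q = q"
| "pmul p PI = p"
| "pmul PX PX = PI" | "pmul PY PY = PI" | "pmul PZ PZ = PI"
| "pmul PX PY = PZ" | "pmul PY PX = PZ"
| "pmul PX PZ = PY" | "pmul PZ PX = PY"
| "pmul PY PZ = PX" | "pmul PZ PY = PX"

type_synonym pop = "pt \<Rightarrow> pauli"

definition opmul :: "pop \<Rightarrow> pop \<Rightarrow> pop" where
  "opmul P Q = (\<lambda>q. pmul (P q) (Q q))"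

definition single :: "pt \<Rightarrow> pauli \<Rightarrow> pop" where
  "single q p = (\<lambda>r. if r = q then p else PI)"

definition stab_gen :: "nat \<Rightarrow> nat \<Rightarrow> nat \<Rightarrow> pt \<Rightarrow> pop" where
  "stab_gen ax ay az s =
     opmul (single (shift ax ay az s (1, 0, 0)) PX)
    (opmul (single (shift ax ay az s (-1, 0, 0)) PX)
    (opmul (single (shift ax ay az s (0, 1, 0)) PY)
    (opmul (single (shift ax ay az s (0, -1, 0)) PY)
    (opmul (single (shift ax ay az s (0, 0, 1)) PZ)
           (single (shift ax ay az s (0, 0, -1)) PZ)))))"

text \<open>The stabilizer group (up to phase): generated by the S_s, s in A - D.
  (Each S_s is its own inverse, so closure under multiplication by generators suffices.)\<close>
inductive_set stab_group :: "nat \<Rightarrow> nat \<Rightarrow> nat \<Rightarrow> pop set" for ax ay az where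
  stab_id: "(\<lambda>_. PI) \<in> stab_group ax ay az"
| stab_step: "P \<in> stab_group ax ay az \<Longrightarrow> s \<in> latA ax ay az - latD ax ay az \<Longrightarrow>
      opmul P (stab_gen ax ay az s) \<in> stab_group ax ay az"

definition anticomm1 :: "pauli \<Rightarrow> pauli \<Rightarrow> bool" where
  "anticomm1 p q \<longleftrightarrow> p \<noteq> PI \<and> q \<noteq> PI \<and> p \<noteq> q"

definition commutes :: "nat \<Rightarrow> nat \<Rightarrow> nat \<Rightarrow> pop \<Rightarrow> pop \<Rightarrow> bool" where
  "commutes ax ay az P Q \<longleftrightarrow>
     even (card {q \<in> latD ax ay az. anticomm1 (P q) (Q q)})"

definition weight :: "nat \<Rightarrow> nat \<Rightarrow> nat \<Rightarrow> pop \<Rightarrow> nat" where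
  "weight ax ay az P = card {q \<in> latD ax ay az. P q \<noteq> PI}"

definition logical_op :: "nat \<Rightarrow> nat \<Rightarrow> nat \<Rightarrow> pop \<Rightarrow> bool" where
  "logical_op ax ay az P \<longleftrightarrow>
     (\<forall>q. q \<notin> latD ax ay az \<longrightarrow> P q = PI) \<and>
     (\<forall>s \<in> latA ax ay az - latD ax ay az. commutes ax ay az P (stab_gen ax ay az s)) \<and>
     P \<notin> stab_group ax ay az"

definition code_distance :: "nat \<Rightarrow> nat \<Rightarrow> nat \<Rightarrow> nat" where
  "code_distance ax ay az = (LEAST w. \<exists>P. logical_op ax ay az P \<and> weight ax ay az P = w)"

end

(* A Pauli operator is encoded by the periodic functions f1, f2 : Z^3 \<rightarrow> F_2 recording where it
   anticommutes with X and with Y. With A, B, C the operators "sum of the two neighbours" in the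
   three directions, f commutes with the stabilizers iff (A + C) f1 = (B + C) f2, and it is a
   stabilizer iff f1 = (B + C) g and f2 = (A + C) g for some g.

   Let the weight be less than n = 2 \<alpha>. The sums of f1 over the diagonal lines of the planes
   x = const satisfy a two-dimensional discrete wave equation with fewer than n nonzero values, which
   forces them to vanish; with the pigeonhole principle f1 then vanishes on a plane x = const of
   either parity. Sweeping through the layers y = 1, ..., n - 2 one finds g such that f1 + (B + C) g
   lives on two layers only. A function on the n x n torus of the form (B + C) h with support in two
   adjacent rows is zero, as its sum over a diamond of side \<alpha> vanishes by periodicity. This,
   with the vanishing line sums and the empty planes, kills the remaining two layers. The same sweep
   in the direction x, with the roles of f1 and f2 exchanged, then deals with f2.

   Conversely, an X-line in direction (0, 1, 1) is a logical operator of weight 2 \<alpha>, since it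
   anticommutes with a Y-line in direction (1, 0, 1). *)
theory Submission
  imports Defs "HOL-Library.Z2"
begin

(* Z2 rewrites addition to XOR, which defeats the ring simplification rules. *)
declare add_bit_eq_xor [simp del] mult_bit_eq_and [simp del] bit_not_zero_iff [simp del]
  minus_bit_def [simp del] uminus_bit_def [simp del]

section \<open>Arithmetic in F_2 and invariance under shifts\<close>

lemmas parity_simps = Z2.bit_eq_iff even_add even_zero

lemma bit_add_self [simp]: "x + x = (0::bit)"
  by (simp add: parity_simps)

lemma bit_add_self_left [simp]: "x + (x + y) = (y::bit)"
  by (simp add: parity_simps)

lemma bit_add_eq_0_iff: "x + y = 0 \<longleftrightarrow> x = (y::bit)"
  by (metis bit_add_self bit_add_self_left add_0_right)

lemma mod_eq_of_shift_eq:
  fixes F :: "int \<Rightarrow> 'a"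
  assumes "\<And>x. F (x + n) = F x"
  shows "F (x mod n) = F x"
proof -
  have shift: "F (y + int k * n) = F y" for y k
  proof (induction k)
    case (Suc k)
    have "F (y + int (Suc k) * n) = F ((y + int k * n) + n)"
      by (simp add: algebra_simps)
    then show ?case
      using assms Suc by simp
  qed simp
  have "F (x mod n) = F x" if "x div n \<ge> 0"
    using shift[of "x mod n" "nat (x div n)"] that by simp
  moreover have "F (x mod n) = F x" if "x div n < 0"
  proof -
    have "x + int (nat (- (x div n))) * n = x mod n"
      using that by (simp add: minus_div_mult_eq_mod[symmetric])
    then show ?thesis
      using shift[of x "nat (- (x div n))"] by simp
  qed
  ultimately show ?thesis
    by linarith
qed

lemma sum_telescope_bit: "(\<Sum>k<n. f (Suc k) + f k) = f n + (f 0 :: bit)"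
  by (induction n) (simp_all add: ac_simps)

section \<open>The discrete wave equation on the torus\<close>

definition per2 :: "nat \<Rightarrow> (int \<Rightarrow> int \<Rightarrow> 'a) \<Rightarrow> bool" where
  "per2 n h \<longleftrightarrow> (\<forall>y z. h (y + int n) z = h y z \<and> h y (z + int n) = h y z)"

text \<open>Over F_2 this is the discrete d'Alembertian, the signs being invisible. Acting on the
  variables (y, z) it is B + C, acting on (x, z) it is A + C.\<close>

definition wave :: "(int \<Rightarrow> int \<Rightarrow> bit) \<Rightarrow> int \<Rightarrow> int \<Rightarrow> bit" where
  "wave h y z = h (y + 1) z + h (y - 1) z + h y (z + 1) + h y (z - 1)"

lemma per2D:
  assumes "per2 n h"
  shows "h (y + int n) z = h y z" "h y (z + int n) = h y z"
    "h (y - int n) z = h y z" "h y (z - int n) = h y z"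
    "h (y mod int n) z = h y z" "h y (z mod int n) = h y z"
proof -
  show 1: "h (y + int n) z = h y z" "h y (z + int n) = h y z" for y z
    using assms by (simp_all add: per2_def)
  show "h (y - int n) z = h y z" "h y (z - int n) = h y z"
    using 1[of "y - int n" z] 1[of y "z - int n"] by simp_all
  show "h (y mod int n) z = h y z"
    using mod_eq_of_shift_eq[of "\<lambda>y. h y z" "int n"] 1 by simp
  show "h y (z mod int n) = h y z"
    using mod_eq_of_shift_eq[of "\<lambda>z. h y z" "int n"] 1 by simp
qed

lemma per2_wave:
  assumes "per2 n h"
  shows "per2 n (wave h)"
proof -
  have "h (y + int n + 1) z = h (y + 1) z" "h (y + int n - 1) z = h (y - 1) z"
    "h y (z + int n + 1) = h y (z + 1)" "h y (z + int n - 1) = h y (z - 1)" for y z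
    using per2D(1)[OF assms, of "y + 1" z] per2D(1)[OF assms, of "y - 1" z]
      per2D(2)[OF assms, of y "z + 1"] per2D(2)[OF assms, of y "z - 1"]
    by (simp_all add: algebra_simps)
  then show ?thesis
    using per2D(1,2)[OF assms] by (simp add: per2_def wave_def)
qed

text \<open>In the light-cone directions (1, 1) and (1, -1) the operator is a mixed second
  difference, so the sum telescopes in both directions and leaves four corners. Opposite corners
  differ by 2 a in one coordinate and cancel by periodicity.\<close>

lemma wave_diamond_sum:
  assumes "per2 (2 * a) h"
  shows "(\<Sum>i<a. \<Sum>j<a. wave h (y + int i + int j) (z + int i - int j)) = 0"
proof -
  define k where "k i j = h (y + int i + int j - 1) (z + int i - int j)" for i j :: nat
  have "wave h (y + int i + int j) (z + int i - int j)
      = (k (Suc i) (Suc j) + k i (Suc j)) + (k (Suc i) j + k i j)" for i j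
    by (simp add: wave_def k_def algebra_simps)
  then have "(\<Sum>i<a. \<Sum>j<a. wave h (y + int i + int j) (z + int i - int j))
      = (\<Sum>i<a. (k (Suc i) a + k i a) + (k (Suc i) 0 + k i 0))"
    using sum_telescope_bit[of "\<lambda>j. k (Suc i) j + k i j" a for i] by simp
  also have "\<dots> = (k a a + k 0 a) + (k a 0 + k 0 0)"
    using sum_telescope_bit[of "\<lambda>i. k i a + k i 0" a] by (simp add: ac_simps)
  also have "k a a = k 0 0"
    using per2D(1)[OF assms, of "y - 1" z] by (simp add: k_def algebra_simps)
  also have "k a 0 = k 0 a"
    using per2D(2)[OF assms, of "y + int a - 1" "z - int a"] by (simp add: k_def algebra_simps)
  finally show ?thesis
    by (simp add: ac_simps)
qed

text \<open>The four neighbours of a point form two pairs, one ahead of it and one behind it along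
  the diagonal, so the sum around the closed line telescopes. The other diagonal direction follows
  by reflecting z.\<close>

lemma wave_row_sum:
  assumes "per2 n h"
  shows "(\<Sum>k<n. wave h (y + int k) (z + int k)) = 0"
    "(\<Sum>k<n. wave h (y + int k) (z - int k)) = 0"
proof -
  have *: "(\<Sum>k<n. wave h (y + int k) (z + int k)) = 0" if "per2 n h" for h z
  proof -
    define t where "t k = h (y + int k) (z + int k - 1) + h (y + int k - 1) (z + int k)" for k :: nat
    have "wave h (y + int k) (z + int k) = t (Suc k) + t k" for k
      by (simp add: wave_def t_def algebra_simps)
    then have "(\<Sum>k<n. wave h (y + int k) (z + int k)) = t n + t 0"
      by (simp add: sum_telescope_bit)
    also have "t n = t 0"
      using per2D(1)[OF that, of y "z + int n - 1"] per2D(2)[OF that, of y "z - 1"]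
         per2D(1)[OF that, of "y - 1" "z + int n"] per2D(2)[OF that, of "y - 1" z]
      by (simp add: t_def algebra_simps)
    finally show ?thesis by simp
  qed
  show "(\<Sum>k<n. wave h (y + int k) (z + int k)) = 0"
    by (rule *) (rule assms)
  have "per2 n (\<lambda>y z. h y (- z))"
    using per2D[OF assms] by (simp add: per2_def)
  from *[OF this, of "- z"] show "(\<Sum>k<n. wave h (y + int k) (z - int k)) = 0"
    by (simp add: wave_def algebra_simps)
qed

lemma sum_diamond_eq_corner:
  fixes F :: "int \<Rightarrow> int \<Rightarrow> bit"
  assumes "a \<ge> 1" "\<And>k z. 1 \<le> k \<Longrightarrow> k \<le> 2 * int a - 2 \<Longrightarrow> F (y + k) z = 0"
  shows "(\<Sum>i<a. \<Sum>j<a. F (y + int i + int j) (z + int i - int j)) = F y z"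
proof -
  have 0: "F (y + int i + int j) w = 0" if "i < a" "j < a" "i + j \<noteq> 0" for i j w
    using assms(2)[of "int i + int j" w] that by (simp add: algebra_simps)
  obtain b where b: "a = Suc b"
    using assms(1) by (cases a) auto
  have "(\<Sum>i<b. \<Sum>j<a. F (y + int (Suc i) + int j) (z + int (Suc i) - int j)) = 0"
    using b 0[of "Suc _"] by (intro sum.neutral ballI) (auto simp flip: of_nat_Suc)
  moreover have "(\<Sum>j<b. F (y + int (Suc j)) (z - int (Suc j))) = 0"
    using b 0[of 0 "Suc _"] by (intro sum.neutral ballI) (auto simp flip: of_nat_Suc)
  ultimately show ?thesis
    unfolding b sum.lessThan_Suc_shift by simp
qed

text \<open>The diamond occupying the rows \<open>0, \<dots>, 2 a - 2\<close> meets the two exceptional rows only in its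
  corner, so its vanishing sum is the value there.\<close>
lemma wave_eq_0_of_two_rows:
  assumes "a \<ge> 2" and h: "per2 (2 * a) h"
    and 0: "\<And>y z. 1 \<le> y \<Longrightarrow> y \<le> 2 * int a - 2 \<Longrightarrow> wave h y z = 0"
  shows "wave h y z = 0"
proof -
  have row0: "wave h 0 z = 0" for z
    using sum_diamond_eq_corner[of a "wave h" 0 z] 0 wave_diamond_sum[OF h, of 0 z] assms(1)
    by simp
  \<comment> \<open>With row 0 cleared, the diamond with its corner in row -1 can be used: its other
    rows are 0 to 2 a - 3.\<close>
  have "wave h (k - 1) z = 0" if "1 \<le> k" "k \<le> 2 * int a - 2" for k z
    using that row0 0[of "k - 1" z] by (cases "k = 1") auto
  then have row1: "wave h (-1) z = 0" for z
    using sum_diamond_eq_corner[of a "wave h" "-1" z] wave_diamond_sum[OF h, of "-1" z] assms(1)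
    by simp
  have "per2 (2 * a) (wave h)"
    by (rule per2_wave[OF h])
  then have "wave h y z = wave h (y mod (2 * int a)) z"
    using per2D(5)[of "2 * a" "wave h" y z] by simp
  moreover have "wave h (y mod (2 * int a)) z = 0"
  proof -
    consider "y mod (2 * int a) = 0" | "y mod (2 * int a) = 2 * int a - 1"
      | "1 \<le> y mod (2 * int a)" "y mod (2 * int a) \<le> 2 * int a - 2"
      using assms(1) pos_mod_bound[of "2 * int a" y] pos_mod_sign[of "2 * int a" y] by linarith
    then show ?thesis
    proof cases
      case 2
      then show ?thesis
        using row1[of z] \<open>per2 (2 * a) (wave h)\<close> per2D(1)[of "2 * a" "wave h" "-1" z]
        by (simp add: add.commute)
    qed (use row0 0 in auto)
  qed
  ultimately show ?thesis by simp
qed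

section \<open>Pigeonhole arguments for residue classes\<close>

lemma exists_fibre_card_le_1:
  assumes "finite T" "finite I" "card T < 2 * card I"
  shows "\<exists>i\<in>I. card {t\<in>T. h t = i} \<le> 1"
proof (rule ccontr)
  assume "\<not> ?thesis"
  then have "(\<Sum>i\<in>I. 2) \<le> (\<Sum>i\<in>I. card {t\<in>T. h t = i})"
    by (intro sum_mono) auto
  also have "\<dots> = card (\<Union>i\<in>I. {t\<in>T. h t = i})"
    using assms by (intro card_UN_disjoint[symmetric]) auto
  also have "\<dots> \<le> card T"
    using assms by (intro card_mono) auto
  finally show False
    using assms by simp
qed

lemma eq_of_dvd_diff:
  assumes "int m dvd int i - int j" "i < m" "j < m"
  shows "i = j"
proof -
  have "int i mod int m = int j mod int m"
    using assms(1) by (simp add: mod_eq_dvd_iff)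
  then show ?thesis
    using assms by simp
qed

text \<open>There are a residues mod 2 a of the parity of r; two points of T in each of them would
  need 2 a points.\<close>

lemma exists_parity_class_card_le_1:
  fixes h :: "'b \<Rightarrow> int"
  assumes "finite T" "card T < 2 * a"
  shows "\<exists>c. even (c - r) \<and> card {t\<in>T. h t mod (2 * int a) = c mod (2 * int a)} \<le> 1"
proof -
  have "inj_on (\<lambda>k. (2 * int k + r) mod (2 * int a)) {..<a}"
  proof (rule inj_onI)
    fix i j
    assume "i \<in> {..<a}" "j \<in> {..<a}" and "(2 * int i + r) mod (2 * int a) = (2 * int j + r) mod (2 * int a)"
    then have "2 * int a dvd 2 * (int i - int j)"
      by (simp add: mod_eq_dvd_iff algebra_simps)
    then have "int a dvd int i - int j"
      by (simp only: dvd_times_left_cancel_iff)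
    with \<open>i \<in> _\<close> \<open>j \<in> _\<close> show "i = j"
      using eq_of_dvd_diff by auto
  qed
  then have "card T < 2 * card ((\<lambda>k. (2 * int k + r) mod (2 * int a)) ` {..<a})"
    using assms by (simp add: card_image)
  from exists_fibre_card_le_1[OF assms(1) _ this, of "\<lambda>t. h t mod (2 * int a)"]
  obtain k where "card {t\<in>T. h t mod (2 * int a) = (2 * int k + r) mod (2 * int a)} \<le> 1"
    by auto
  then show ?thesis
    by (intro exI[of _ "2 * int k + r"]) simp
qed

text \<open>Keeps u apart from u + 1, u + a and u + 1 + a on the cycle of length 2 a. For a = 1 the
  last of them would wrap around to u.\<close>

lemma add_half_period_neq:
  assumes "a \<ge> 2"
  shows "(x + int a) mod (2 * int a) \<noteq> x mod (2 * int a)"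
    "(x + 1 + int a) mod (2 * int a) \<noteq> x mod (2 * int a)"
    "(x + 1) mod (2 * int a) \<noteq> x mod (2 * int a)"
proof -
  have "\<not> 2 * int a dvd int a" "\<not> 2 * int a dvd 1 + int a" "\<not> 2 * int a dvd 1"
    using assms zdvd_imp_le[of "2 * int a" "int a"] zdvd_imp_le[of "2 * int a" "1 + int a"]
      zdvd_imp_le[of "2 * int a" 1] by auto
  then show "(x + int a) mod (2 * int a) \<noteq> x mod (2 * int a)"
    "(x + 1 + int a) mod (2 * int a) \<noteq> x mod (2 * int a)"
    "(x + 1) mod (2 * int a) \<noteq> x mod (2 * int a)"
    by (simp_all add: mod_eq_dvd_iff)
qed

text \<open>By the wave equation the difference D along (1, 1) is constant along (1, -1), so on even
  points it suffices that D vanishes on one diagonal w - x = c with c even. The pigeonhole principle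
  supplies such a diagonal with at most one point of T.\<close>

lemma wave_small_support_diagonal:
  assumes "a \<ge> 2" and l: "per2 (2 * a) l" and wave: "\<And>x w. wave l x w = 0"
    and odd: "\<And>x w. odd (x + w) \<Longrightarrow> l x w = 0"
    and T: "finite T" "card T < 2 * a"
    and supp: "\<And>x w. l x w \<noteq> 0 \<Longrightarrow> (x mod (2 * int a), w mod (2 * int a)) \<in> T"
  shows "l (x + 1) (w + 1) = l x w"
proof -
  define D where "D x w = l (x + 1) (w + 1) + l x w" for x w
  have step: "D x w = D (x - 1) (w + 1)" for x w
  proof -
    have "D x w + D (x - 1) (w + 1) = wave l x (w + 1)"
      by (simp add: D_def wave_def algebra_simps)
    then show ?thesis
      by (simp add: wave bit_add_eq_0_iff)
  qed
  have shift: "D x w = D (x - int k) (w + int k)" for x w k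
  proof (induction k)
    case (Suc k)
    then show ?case
      using step[of "x - int k" "w + int k"] by (simp add: algebra_simps)
  qed simp
  \<comment> \<open>Moving a steps along (1, -1) turns (x + a, w + a) into (x, w + 2 a), which is
    (x, w) by periodicity.\<close>
  have half: "D (x + int a) (w + int a) = D x w" for x w
    using shift[of "x + int a" "w + int a" a] shift[of x w 0]
      per2D(2)[OF l, of x w] per2D(2)[OF l, of "x + 1" "w + 1"]
    by (simp add: D_def algebra_simps)
  obtain c where c: "even c"
    and card: "card {t\<in>T. (snd t - fst t) mod (2 * int a) = c mod (2 * int a)} \<le> 1"
    using exists_parity_class_card_le_1[OF T, of 0 "\<lambda>t. snd t - fst t"] by auto
  define m where "m u = l u (u + c)" for u
  have m1: "u mod (2 * int a) = v mod (2 * int a)" if "m u \<noteq> 0" "m v \<noteq> 0" for u v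
  proof -
    have "(u mod (2 * int a), (u + c) mod (2 * int a)) = (v mod (2 * int a), (v + c) mod (2 * int a))"
    proof (rule card_le_Suc0_iff_eq[THEN iffD1, rule_format, OF _ card[unfolded One_nat_def]])
    qed (use supp that T in \<open>auto simp: m_def mod_simps\<close>)
    then show ?thesis by simp
  qed
  \<comment> \<open>The half-period of D, read on the diagonal, where D is the difference of
    consecutive values of \<open>m\<close>. A lone nonzero value of \<open>m\<close> would have no
    partner in this identity.\<close>
  have m_shift: "m (u + 1) + m (u + 1 + int a) = m u + m (u + int a)" for u
  proof -
    have "(m (u + 1) + m (u + 1 + int a)) + (m u + m (u + int a))
        = D (u + int a) (u + c + int a) + D u (u + c)"
      by (simp add: D_def m_def algebra_simps)
    then show ?thesis
      by (simp add: half bit_add_eq_0_iff)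
  qed
  have m0: "m u = 0" for u
  proof (rule ccontr)
    assume u: "m u \<noteq> 0"
    then have "m (u + int a) = 0" "m (u + 1) = 0" "m (u + 1 + int a) = 0"
      using m1[of "u + int a" u] m1[of "u + 1" u] m1[of "u + 1 + int a" u]
        add_half_period_neq[OF \<open>a \<ge> 2\<close>, of u] by blast+
    then show False
      using m_shift[of u] u by simp
  qed
  have "D x w = 0"
  proof (cases "even (x + w)")
    case True
    then have "even (w - x - c)"
      using c by simp
    \<comment> \<open>The antidiagonal through (x, w) meets the chosen diagonal in (x + j, w - j);
      the parities make j an integer.\<close>
    then obtain j where j: "w = x + 2 * j + c"
      by (metis add.commute add_diff_cancel_left' add_diff_eq diff_diff_eq2 evenE)
    have "D x w = D (x + j) (w - j)"
    proof (cases "j \<ge> 0")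
      case True
      then show ?thesis
        using shift[of "x + j" "w - j" "nat j"] by simp
    next
      case False
      then show ?thesis
        by (subst shift[of x w "nat (- j)"]) simp
    qed
    then have "D x w = D (x + j) (x + j + c)"
      unfolding j by (simp add: algebra_simps)
    then show ?thesis
      using m0[of "x + j"] m0[of "x + j + 1"] by (simp add: D_def m_def algebra_simps)
  qed (simp add: D_def odd)
  then show ?thesis
    by (simp add: D_def bit_add_eq_0_iff)
qed

text \<open>Invariance along (1, 1) repeats a nonzero value at 2 a distinct points of the torus,
  more than T has.\<close>

lemma wave_eq_0_of_small_support:
  assumes "a \<ge> 2" and l: "per2 (2 * a) l" and wave: "\<And>x w. wave l x w = 0"
    and odd: "\<And>x w. odd (x + w) \<Longrightarrow> l x w = 0"
    and T: "finite T" "card T < 2 * a"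
    and supp: "\<And>x w. l x w \<noteq> 0 \<Longrightarrow> (x mod (2 * int a), w mod (2 * int a)) \<in> T"
  shows "l x w = 0"
proof -
  have d1: "l (x + 1) (w + 1) = l x w" for x w
    by (rule wave_small_support_diagonal[OF assms])
  have diag: "l (x + int k) (w + int k) = l x w" for k
  proof (induction k)
    case (Suc k)
    then show ?case
      using d1[of "x + int k" "w + int k"] by (simp add: algebra_simps)
  qed simp
  show ?thesis
  proof (rule ccontr)
    assume "l x w \<noteq> 0"
    have "inj_on (\<lambda>k. ((x + int k) mod (2 * int a), (w + int k) mod (2 * int a))) {..<2 * a}"
    proof (rule inj_onI)
      fix i j
      assume "i \<in> {..<2 * a}" "j \<in> {..<2 * a}"
        "((x + int i) mod (2 * int a), (w + int i) mod (2 * int a))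
         = ((x + int j) mod (2 * int a), (w + int j) mod (2 * int a))"
      then have "2 * int a dvd int i - int j"
        by (simp add: mod_eq_dvd_iff)
      with \<open>i \<in> _\<close> \<open>j \<in> _\<close> show "i = j"
        using eq_of_dvd_diff[of "2 * a" i j] by simp
    qed
    then have "2 * a = card ((\<lambda>k. ((x + int k) mod (2 * int a), (w + int k) mod (2 * int a))) ` {..<2 * a})"
      by (simp add: card_image)
    also have "\<dots> \<le> card T"
    proof (rule card_mono[OF T(1)])
    qed (use supp \<open>l x w \<noteq> 0\<close> diag in auto)
    finally show False
      using T by simp
  qed
qed

section \<open>Line sums and empty planes\<close>

definition per3 :: "nat \<Rightarrow> (int \<Rightarrow> int \<Rightarrow> int \<Rightarrow> 'a) \<Rightarrow> bool" where
  "per3 n f \<longleftrightarrow> (\<forall>x y z. f (x + int n) y z = f x y z \<and> f x (y + int n) z = f x y z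
     \<and> f x y (z + int n) = f x y z)"

lemma per3D:
  assumes "per3 n f"
  shows "f (x + int n) y z = f x y z" "f x (y + int n) z = f x y z" "f x y (z + int n) = f x y z"
  using assms by (simp_all add: per3_def)

lemma per3_slice:
  assumes "per3 n f"
  shows "per2 n (f x)" "per2 n (\<lambda>x z. f x y z)"
  using assms by (simp_all add: per3_def per2_def)

lemma per3_add: "per3 n f \<Longrightarrow> per3 n g \<Longrightarrow> per3 n (\<lambda>x y z. f x y z + g x y z)"
  by (simp add: per3_def)

lemma per3_wave:
  assumes "per3 n g"
  shows "per3 n (\<lambda>x y z. wave (g x) y z)" "per3 n (\<lambda>x y z. wave (\<lambda>x z. g x y z) x z)"
  using per2_wave[OF per3_slice(1)[OF assms]] per2_wave[OF per3_slice(2)[OF assms]] per3D[OF assms]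
    wave_def[of "g (_ + _)"] wave_def[of "\<lambda>x z. g x (_ + _) z"]
  by (simp_all add: per3_def per2_def wave_def)

lemma wave_commute:
  "wave (\<lambda>x z. wave (g x) y z) x z = wave (\<lambda>y z. wave (\<lambda>x z. g x y z) x z) y z"
  by (simp add: wave_def algebra_simps)

lemma wave_add: "wave (\<lambda>y z. F y z + G y z) y z = wave F y z + wave G y z"
  by (simp add: wave_def ac_simps)

lemma sum_period_shift:
  fixes F :: "int \<Rightarrow> bit"
  assumes "\<And>k. F (k + int n) = F k"
  shows "(\<Sum>k<n. F (y + int k)) = (\<Sum>k<n. F (int k))"
proof -
  have "(\<Sum>k<n. F (y + 1 + int k)) = (\<Sum>k<n. F (y + int k))" for y
  proof -
    have "(\<Sum>k<n. F (y + 1 + int k)) + (\<Sum>k<n. F (y + int k))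
        = (\<Sum>k<n. F (y + int (Suc k)) + F (y + int k))"
      by (simp add: sum.distrib algebra_simps)
    also have "\<dots> = 0"
      using sum_telescope_bit[of "\<lambda>k. F (y + int k)" n] assms[of y] by simp
    finally show ?thesis
      by (simp add: bit_add_eq_0_iff)
  qed
  \<comment> \<open>A function of y with period 1 is constant, as y mod 1 = 0.\<close>
  then have "(\<Sum>k<n. F (y mod 1 + int k)) = (\<Sum>k<n. F (y + int k))"
    by (rule mod_eq_of_shift_eq)
  then show ?thesis by simp
qed

text \<open>Summation over the lines z - y = w of the plane x turns A + C into the wave operator in
  (x, w) and annihilates (B + C) f2. So the line sums solve the wave equation, with support inside a
  projection of W.\<close>

lemma line_sum_eq_0_of_small_support:
  assumes "a \<ge> 2" and per: "per3 (2 * a) f1" "per3 (2 * a) f2"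
    and eq: "\<And>x y z. wave (\<lambda>x z. f1 x y z) x z = wave (f2 x) y z"
    and odd: "\<And>x y z. odd (x + y + z) \<Longrightarrow> f1 x y z = 0"
    and W: "finite W" "card W < 2 * a"
    and supp: "\<And>x y z. f1 x y z \<noteq> 0 \<Longrightarrow>
      (x mod (2 * int a), y mod (2 * int a), z mod (2 * int a)) \<in> W"
  shows "(\<Sum>k<2 * a. f1 x (y + int k) (z + int k)) = 0"
proof -
  define l where "l x w = (\<Sum>k<2 * a. f1 x (int k) (w + int k))" for x w
  define T where "T = (\<lambda>(x, y, z). (x, (z - y) mod (2 * int a))) ` W"
  have "l x (z - y) = 0"
  proof (rule wave_eq_0_of_small_support[of a l T])
    show "per2 (2 * a) l"
      using per3D[OF per(1)] by (simp add: per2_def l_def add.assoc add.commute[of "2 * int a"])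
        (simp add: add.assoc[symmetric])
    show "wave l x w = 0" for x w
    proof -
      have "wave l x w = (\<Sum>k<2 * a. wave (\<lambda>x z. f1 x (int k) z) x (w + int k))"
        by (simp add: l_def wave_def sum.distrib algebra_simps)
      also have "\<dots> = 0"
        using wave_row_sum(1)[OF per3_slice(1)[OF per(2)], of x 0 w] eq by simp
      finally show ?thesis .
    qed
    show "l x w = 0" if "odd (x + w)" for x w
      unfolding l_def using that by (intro sum.neutral ballI odd) simp
    show "finite T"
      using W by (simp add: T_def)
    show "card T < 2 * a"
      unfolding T_def using card_image_le[OF W(1)] W(2) by (rule le_less_trans)
    show "(x mod (2 * int a), w mod (2 * int a)) \<in> T" if "l x w \<noteq> 0" for x w
    proof -
      obtain k where "f1 x (int k) (w + int k) \<noteq> 0"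
        using \<open>l x w \<noteq> 0\<close> unfolding l_def by (meson sum.neutral)
      from imageI[OF supp[OF this], of "\<lambda>(x, y, z). (x, (z - y) mod (2 * int a))"]
      show ?thesis
        by (simp add: T_def mod_simps)
    qed
  qed fact
  moreover have "(\<Sum>k<2 * a. f1 x (y + int k) (z - y + (y + int k))) = l x (z - y)"
    unfolding l_def
  proof (rule sum_period_shift)
    show "f1 x (k + int (2 * a)) (z - y + (k + int (2 * a))) = f1 x k (z - y + k)" for k
      using per3D(2)[OF per(1), of x k "z - y + (k + int (2 * a))"]
        per3D(3)[OF per(1), of x k "z - y + k"] by (simp add: add.assoc)
  qed
  ultimately show ?thesis
    by (simp add: algebra_simps)
qed

text \<open>Some plane x = c with c of the parity of r has at most one point of W. A single nonzero
  value in it would be a nonzero line sum.\<close>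

lemma exists_plane_eq_0:
  assumes per: "per3 (2 * a) f"
    and lines: "\<And>x y z. (\<Sum>k<2 * a. f x (y + int k) (z + int k)) = (0 :: bit)"
    and W: "finite W" "card W < 2 * a"
    and supp: "\<And>x y z. f x y z \<noteq> 0 \<Longrightarrow>
      (x mod (2 * int a), y mod (2 * int a), z mod (2 * int a)) \<in> W"
  shows "\<exists>c. even (c - r) \<and> (\<forall>y z. f c y z = 0)"
proof -
  obtain c where c: "even (c - r)" "card {t\<in>W. fst t mod (2 * int a) = c mod (2 * int a)} \<le> 1"
    using exists_parity_class_card_le_1[OF W, of r fst] by auto
  have "f c y z = 0" for y z
  proof (rule ccontr)
    assume nz: "f c y z \<noteq> 0"
    have zero: "f c (y + int k) (z + int k) = 0" if "k < 2 * a" "k \<noteq> 0" for k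
    proof (rule ccontr)
      assume nz': "f c (y + int k) (z + int k) \<noteq> 0"
      have "(c mod (2 * int a), y mod (2 * int a), z mod (2 * int a))
          = (c mod (2 * int a), (y + int k) mod (2 * int a), (z + int k) mod (2 * int a))"
      proof (rule card_le_Suc0_iff_eq[THEN iffD1, rule_format, OF _ c(2)[unfolded One_nat_def]])
      qed (use supp[OF nz] supp[OF nz'] W in auto)
      then have "int (2 * a) dvd int k - int 0"
        by (simp add: mod_eq_dvd_iff)
      then show False
        using eq_of_dvd_diff[of "2 * a" k 0] that by simp
    qed
    obtain b where b: "2 * a = Suc b"
      using W by (cases "2 * a") auto
    have "(\<Sum>k<b. f c (y + int (Suc k)) (z + int (Suc k))) = 0"
      using b by (intro sum.neutral ballI zero) auto
    then have "f c y z = 0"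
      using lines[of c y z] unfolding b sum.lessThan_Suc_shift by simp
    with nz show False ..
  qed
  with c show ?thesis by blast
qed

text \<open>A diagonal line of either direction meets each of the rows 0 and -1 once. Vanishing line
  sums make row 0 at z + 1 and at z - 1 both equal to row -1 at z.\<close>

lemma two_row_slab:
  assumes "a \<ge> 1" and F: "per2 (2 * a) (F :: int \<Rightarrow> int \<Rightarrow> bit)"
    and 0: "\<And>y z. 1 \<le> y \<Longrightarrow> y \<le> 2 * int a - 2 \<Longrightarrow> F y z = 0"
    and lines: "\<And>y z. (\<Sum>k<2 * a. F (y + int k) (z + int k)) = 0"
      "\<And>y z. (\<Sum>k<2 * a. F (y + int k) (z - int k)) = 0"
  shows "F y (z + 1) = F y (z - 1)"
proof -
  obtain b where b: "2 * a = Suc (Suc b)"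
    using assms(1) by (cases a) auto
  have 00: "F (- 1 + int (Suc (Suc k))) w = 0" if "k < b" for k w
    using that b by (intro 0) auto
  have 1: "F 0 (z + 1) = F (- 1) z" for z
  proof -
    have "(\<Sum>k<b. F (- 1 + int (Suc (Suc k))) (z + int (Suc (Suc k)))) = 0"
      by (intro sum.neutral ballI 00) auto
    then show ?thesis
      using lines(1)[of "- 1" z] unfolding b sum.lessThan_Suc_shift
      by (simp add: bit_add_eq_0_iff)
  qed
  have 2: "F 0 (z - 1) = F (- 1) z" for z
  proof -
    have "(\<Sum>k<b. F (- 1 + int (Suc (Suc k))) (z - int (Suc (Suc k)))) = 0"
      by (intro sum.neutral ballI 00) auto
    then show ?thesis
      using lines(2)[of "- 1" z] unfolding b sum.lessThan_Suc_shift
      by (simp add: bit_add_eq_0_iff)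
  qed
  have "F (y mod int (2 * a)) (z + 1) = F (y mod int (2 * a)) (z - 1)"
  proof -
    consider "y mod (2 * int a) = 0" | "y mod (2 * int a) = 2 * int a - 1"
      | "1 \<le> y mod (2 * int a)" "y mod (2 * int a) \<le> 2 * int a - 2"
      using assms(1) pos_mod_bound[of "2 * int a" y] pos_mod_sign[of "2 * int a" y] by linarith
    then show ?thesis
    proof cases
      case 1
      then show ?thesis
        using \<open>\<And>z. F 0 (z + 1) = F (- 1) z\<close> 2 by simp
    next
      case row: 2
      have "F (2 * int a - 1) w = F (- 1) w" for w
        using per2D(1)[OF F, of "- 1" w] by (simp add: add.commute)
      then show ?thesis
        using row 1[of "z - 1"] 2[of "z + 1"] by simp
    next
      case 3
      then show ?thesis
        by (simp add: 0)
    qed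
  qed
  then show ?thesis
    by (simp only: per2D(5)[OF F])
qed

section \<open>The sweep\<close>

text \<open>\<open>sweep f k\<close> is the layer y = k of a solution g of f = (B + C) g: the
  equation at y = k + 1 is solved for the layer k + 2, starting from zero layers 0 and 1.\<close>

fun sweep :: "(int \<Rightarrow> int \<Rightarrow> int \<Rightarrow> bit) \<Rightarrow> nat \<Rightarrow> int \<Rightarrow> int \<Rightarrow> bit" where
  "sweep f 0 x z = 0"
| "sweep f (Suc 0) x z = 0"
| "sweep f (Suc (Suc k)) x z =
     sweep f k x z + sweep f (Suc k) x (z + 1) + sweep f (Suc k) x (z - 1) + f x (int k + 1) z"

lemma sweep_per2:
  assumes "per3 n f"
  shows "per2 n (sweep f k)"
proof -
  have shift: "per2 n (\<lambda>y z. h y (z + c))" if "per2 n h" for h :: "int \<Rightarrow> int \<Rightarrow> bit" and c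
    using per2D(1,2)[OF that] by (simp add: per2_def add.assoc add.commute[of "int n" c])
      (simp flip: add.assoc)
  have "per2 n (sweep f k) \<and> per2 n (sweep f (Suc k))"
  proof (induction k)
    case (Suc k)
    then show ?case
      using shift[of "sweep f (Suc k)" 1] shift[of "sweep f (Suc k)" "- 1"] per3D[OF assms]
      by (simp add: per2_def)
  qed (simp add: per2_def)
  then show ?thesis ..
qed

text \<open>The layers arise from f by shifts and sums, which commute with A + C. This keeps the
  second sweep from disturbing the function treated by the first.\<close>

lemma sweep_wave:
  assumes "\<And>x y z. wave (\<lambda>x z. f x y z) x z = 0"
  shows "wave (sweep f k) x z = 0"
proof -
  have "wave (sweep f (Suc (Suc k))) x z = wave (sweep f k) x z + wave (sweep f (Suc k)) x (z + 1)
      + wave (sweep f (Suc k)) x (z - 1) + wave (\<lambda>x z. f x (int k + 1) z) x z" for k x z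
    by (simp add: wave_def algebra_simps)
  then have "(\<forall>x z. wave (sweep f k) x z = 0) \<and> (\<forall>x z. wave (sweep f (Suc k)) x z = 0)"
    by (induction k) (simp_all add: assms, simp_all add: wave_def)
  then show ?thesis by blast
qed

text \<open>The remainder F = f1 + (B + C) g lives on two layers; it turns out to have period 2 in x
  and to vanish on a plane of each parity. The two planes may carry a boundary \<open>wave h\<close>
  instead of 0, because in the second sweep the correction from the first is present there.\<close>

lemma sweep_to_wave:
  assumes "a \<ge> 2" and per: "per3 (2 * a) f1" "per3 (2 * a) f2"
    and eq: "\<And>x y z. wave (\<lambda>x z. f1 x y z) x z = wave (f2 x) y z"
    and lines: "\<And>x y z. (\<Sum>k<2 * a. f1 x (y + int k) (z + int k)) = 0"
      "\<And>x y z. (\<Sum>k<2 * a. f1 x (y + int k) (z - int k)) = 0"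
    and plane0: "even x0" "per2 (2 * a) h0" "\<And>y z. f1 x0 y z = wave h0 y z"
    and plane1: "odd x1" "per2 (2 * a) h1" "\<And>y z. f1 x1 y z = wave h1 y z"
  obtains g where "per3 (2 * a) g" "\<And>x y z. f1 x y z = wave (g x) y z"
    "(\<forall>x y z. wave (\<lambda>x z. f1 x y z) x z = 0) \<longrightarrow> (\<forall>x y z. wave (\<lambda>x z. g x y z) x z = 0)"
proof
  \<comment> \<open>The layers 0 to 2 a - 1 are repeated periodically; the equation can fail only at
    the seam, in the rows -1 and 0.\<close>
  define g where "g x y z = sweep f1 (nat (y mod int (2 * a))) x z" for x y z
  show per_g: "per3 (2 * a) g"
    using per2D[OF sweep_per2[OF per(1)]] by (simp add: per3_def g_def)
  show "(\<forall>x y z. wave (\<lambda>x z. f1 x y z) x z = 0) \<longrightarrow> (\<forall>x y z. wave (\<lambda>x z. g x y z) x z = 0)"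
    using sweep_wave[of f1] by (simp add: g_def[abs_def])
  define F where "F x y z = f1 x y z + wave (g x) y z" for x y z
  have per_F: "per3 (2 * a) F"
    unfolding F_def[abs_def] by (intro per3_add per3_wave per per_g)
  have rows: "F x y z = 0" if "1 \<le> y" "y \<le> 2 * int a - 2" for x y z
  proof -
    have "y = int (Suc (nat (y - 1)))"
      using that(1) by simp
    then obtain k where y: "y = int (Suc k)" ..
    have g: "g x (y + j) w = sweep f1 (nat (y + j)) x w" if "j \<in> {- 1, 0, 1}" for j w
    proof -
      have "(y + j) mod (2 * int a) = y + j"
        using that \<open>1 \<le> y\<close> \<open>y \<le> 2 * int a - 2\<close> by (intro mod_pos_pos_trivial) auto
      then show ?thesis
        by (simp add: g_def)
    qed
    have "nat (y + 1) = Suc (Suc k)" "nat y = Suc k" "nat (y - 1) = k"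
      using y by auto
    then have "g x (y + 1) w = sweep f1 (Suc (Suc k)) x w" "g x y w = sweep f1 (Suc k) x w"
      "g x (y - 1) w = sweep f1 k x w" for w
      using g[of 1 w] g[of 0 w] g[of "- 1" w] by simp_all
    then show ?thesis
      by (simp add: F_def wave_def y algebra_simps)
  qed
  \<comment> \<open>As A + C and B + C commute, (A + C) F is again of the form (B + C) h, and the
    two-row lemma applies to it.\<close>
  have F_eq: "wave (\<lambda>x z. F x y z) x z = wave (\<lambda>y z. f2 x y z + wave (\<lambda>x z. g x y z) x z) y z" for x y z
    unfolding F_def wave_add eq by (rule arg_cong[OF wave_commute])
  have F_wave: "wave (\<lambda>x z. F x y z) x z = 0" for x y z
    unfolding F_eq
  proof (rule wave_eq_0_of_two_rows[OF \<open>a \<ge> 2\<close>])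
    show "per2 (2 * a) (\<lambda>y z. f2 x y z + wave (\<lambda>x z. g x y z) x z)"
      using per3_slice(1)[OF per3_add[OF per(2) per3_wave(2)[OF per_g]]] .
    show "wave (\<lambda>y z. f2 x y z + wave (\<lambda>x z. g x y z) x z) y z = 0"
      if "1 \<le> y" "y \<le> 2 * int a - 2" for y z
      unfolding F_eq[symmetric] using rows[OF that] by (simp add: wave_def)
  qed
  have F_lines: "(\<Sum>k<2 * a. F x (y + int k) (z + int k)) = 0"
    "(\<Sum>k<2 * a. F x (y + int k) (z - int k)) = 0" for x y z
    using lines wave_row_sum[OF per3_slice(1)[OF per_g]] by (simp_all add: F_def sum.distrib)
  have slab: "F x y (z + 1) = F x y (z - 1)" for x y z
    by (rule two_row_slab[of a]) (use \<open>a \<ge> 2\<close> per3_slice(1)[OF per_F] rows F_lines in auto)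
  \<comment> \<open>By \<open>slab\<close>, C F = 0, so (A + C) F = 0 reduces to A F = 0.\<close>
  have F_step: "F (x + 2) = F x" for x
  proof (intro ext)
    fix y z
    have "F (x + 2) y z + F x y z = wave (\<lambda>x z. F x y z) (x + 1) z"
      using slab[of "x + 1" y z] by (simp add: wave_def add.assoc)
    then show "F (x + 2) y z = F x y z"
      by (simp add: F_wave bit_add_eq_0_iff)
  qed
  have F_plane: "F c y z = 0" if "per2 (2 * a) h" "\<And>y z. f1 c y z = wave h y z" for c h y z
  proof -
    have *: "F c y z = wave (\<lambda>y z. h y z + g c y z) y z" for y z
      by (simp add: F_def that wave_add)
    show ?thesis
      unfolding *
    proof (rule wave_eq_0_of_two_rows[OF \<open>a \<ge> 2\<close>])
      show "per2 (2 * a) (\<lambda>y z. h y z + g c y z)"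
        using that(1) per3_slice(1)[OF per_g] by (simp add: per2_def)
    qed (simp add: rows flip: *)
  qed
  have "F x y z = 0" for x y z
  proof -
    have mod2: "F (x mod 2) = F x" for x
      by (rule mod_eq_of_shift_eq) (rule F_step)
    consider "x mod 2 = x0 mod 2" | "x mod 2 = x1 mod 2"
      using plane0(1) plane1(1) by (metis odd_iff_mod_2_eq_one even_iff_mod_2_eq_zero)
    then show ?thesis
      using mod2[of x] mod2[of x0] mod2[of x1] F_plane[OF plane0(2,3), of y z]
        F_plane[OF plane1(2,3), of y z]
      by cases metis+
  qed
  then show "f1 x y z = wave (g x) y z" for x y z
    by (simp add: F_def bit_add_eq_0_iff)
qed

section \<open>From small support to a common potential g\<close>

lemma small_support_lines_and_planes:
  assumes "a \<ge> 2" and per: "per3 (2 * a) f1" "per3 (2 * a) f2"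
    and eq: "\<And>x y z. wave (\<lambda>x z. f1 x y z) x z = wave (f2 x) y z"
    and odd: "\<And>x y z. odd (x + y + z) \<Longrightarrow> f1 x y z = 0"
    and W: "finite W" "card W < 2 * a"
    and supp: "\<And>x y z. f1 x y z \<noteq> 0 \<Longrightarrow>
      (x mod (2 * int a), y mod (2 * int a), z mod (2 * int a)) \<in> W"
  shows "(\<Sum>k<2 * a. f1 x (y + int k) (z + int k)) = 0"
    "(\<Sum>k<2 * a. f1 x (y + int k) (z - int k)) = 0"
    "\<exists>c. even (c - r) \<and> (\<forall>y z. f1 c y z = 0)"
proof -
  show lines: "(\<Sum>k<2 * a. f1 x (y + int k) (z + int k)) = 0" for x y z
    by (rule line_sum_eq_0_of_small_support[OF assms])
  show "\<exists>c. even (c - r) \<and> (\<forall>y z. f1 c y z = 0)"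
    by (rule exists_plane_eq_0[OF per(1) lines W supp])
  \<comment> \<open>The reflection of z preserves all hypotheses and exchanges the two diagonal
    directions.\<close>
  let ?W = "(\<lambda>(x, y, z). (x, y, (- z) mod (2 * int a))) ` W"
  have "(\<Sum>k<2 * a. f1 x (y + int k) (- (- z + int k))) = 0"
  proof (rule line_sum_eq_0_of_small_support[of a "\<lambda>x y z. f1 x y (- z)"
        "\<lambda>x y z. f2 x y (- z)" ?W, OF \<open>a \<ge> 2\<close>])
    show "per3 (2 * a) (\<lambda>x y z. f1 x y (- z))" "per3 (2 * a) (\<lambda>x y z. f2 x y (- z))"
      using per3D[OF per(1)] per3D[OF per(2)] per2D(4)[OF per3_slice(1)[OF per(1)]]
        per2D(4)[OF per3_slice(1)[OF per(2)]] by (simp_all add: per3_def)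
    show "wave (\<lambda>x z. f1 x y (- z)) x z = wave (\<lambda>y z. f2 x y (- z)) y z" for x y z
      using eq[of y x "- z"] by (simp add: wave_def algebra_simps minus_diff_commute)
    show "card ?W < 2 * a"
      using card_image_le[OF W(1)] W(2) by (rule le_less_trans)
    show "(x mod (2 * int a), y mod (2 * int a), z mod (2 * int a)) \<in> ?W"
      if "f1 x y (- z) \<noteq> 0" for x y z
      using imageI[OF supp[OF that], of "\<lambda>(x, y, z). (x, y, (- z) mod (2 * int a))"]
      by (simp add: mod_minus_eq)
  qed (use odd W in auto)
  then show "(\<Sum>k<2 * a. f1 x (y + int k) (z - int k)) = 0"
    by (simp add: algebra_simps)
qed

text \<open>Once f1 = (B + C) g1, the remainder F = f2 + (A + C) g1 satisfies (B + C) F = 0. The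
  sweep in x gives F = (A + C) g2 with (B + C) g2 = 0, so g1 + g2 serves both functions.\<close>

theorem small_support_is_boundary:
  assumes "a \<ge> 2" and per: "per3 (2 * a) f1" "per3 (2 * a) f2"
    and eq: "\<And>x y z. wave (\<lambda>x z. f1 x y z) x z = wave (f2 x) y z"
    and odd: "\<And>x y z. odd (x + y + z) \<Longrightarrow> f1 x y z = 0 \<and> f2 x y z = 0"
    and W: "finite W" "card W < 2 * a"
    and supp: "\<And>x y z. f1 x y z \<noteq> 0 \<or> f2 x y z \<noteq> 0 \<Longrightarrow>
      (x mod (2 * int a), y mod (2 * int a), z mod (2 * int a)) \<in> W"
  obtains g where "per3 (2 * a) g" "\<And>x y z. f1 x y z = wave (g x) y z"
    "\<And>x y z. f2 x y z = wave (\<lambda>x z. g x y z) x z"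
proof -
  have per_swap: "per3 n (\<lambda>x y z. f y x z)" if "per3 n f" for n and f :: "int \<Rightarrow> int \<Rightarrow> int \<Rightarrow> bit"
    using that by (simp add: per3_def)
  let ?W = "(\<lambda>(x, y, z). (y, x, z)) ` W"
  have F2: "(\<Sum>k<2 * a. f2 (x + int k) y (z + int k)) = 0"
    "(\<Sum>k<2 * a. f2 (x + int k) y (z - int k)) = 0"
    "\<exists>c. even (c - r) \<and> (\<forall>x z. f2 x c z = 0)" for x y z r
  proof -
    have W': "finite ?W" "card ?W < 2 * a"
      using W card_image_le[OF W(1), of "\<lambda>(x, y, z). (y, x, z)"] by auto
    have supp': "(x mod (2 * int a), y mod (2 * int a), z mod (2 * int a)) \<in> ?W"
      if "f2 y x z \<noteq> 0" for x y z
      using imageI[OF supp[of y x z], of "\<lambda>(x, y, z). (y, x, z)"] that by simp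
    have odd': "f2 y x z = 0" if "odd (x + y + z)" for x y z
      using odd[of y x z] that by (auto simp: add.commute)
    note * = small_support_lines_and_planes[of a "\<lambda>x y z. f2 y x z" "\<lambda>x y z. f1 y x z" ?W,
        OF \<open>a \<ge> 2\<close> per_swap[OF per(2)] per_swap[OF per(1)] eq[symmetric] odd' W' supp']
    show "(\<Sum>k<2 * a. f2 (x + int k) y (z + int k)) = 0"
      "(\<Sum>k<2 * a. f2 (x + int k) y (z - int k)) = 0"
      "\<exists>c. even (c - r) \<and> (\<forall>x z. f2 x c z = 0)"
      using * by simp_all
  qed
  have F1: "(\<Sum>k<2 * a. f1 x (y + int k) (z + int k)) = 0"
    "(\<Sum>k<2 * a. f1 x (y + int k) (z - int k)) = 0"
    "\<exists>c. even (c - r) \<and> (\<forall>y z. f1 c y z = 0)" for x y z r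
    using small_support_lines_and_planes[OF \<open>a \<ge> 2\<close> per eq _ W] odd supp by simp_all
  have per0: "per2 (2 * a) (\<lambda>y z. 0 :: bit)"
    by (simp add: per2_def)
  obtain x0 where x0: "even x0" "\<And>y z. f1 x0 y z = 0"
    using F1(3)[of 0] by auto
  obtain x1 where x1: "odd x1" "\<And>y z. f1 x1 y z = 0"
    using F1(3)[of 1] by auto
  obtain g1 where g1: "per3 (2 * a) g1" "\<And>x y z. f1 x y z = wave (g1 x) y z"
    by (rule sweep_to_wave[OF \<open>a \<ge> 2\<close> per eq F1(1,2) x0(1) per0 _ x1(1) per0])
      (simp_all add: x0 x1 wave_def)
  define F where "F y x z = f2 x y z + wave (\<lambda>x z. g1 x y z) x z" for x y z
  have per_F: "per3 (2 * a) F"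
    unfolding F_def[abs_def] by (rule per_swap, intro per3_add per per3_wave g1)
  have F_wave: "wave (\<lambda>y z. F y x z) y z = 0" for x y z
  proof -
    have "wave (\<lambda>y z. F y x z) y z
        = wave (f2 x) y z + wave (\<lambda>x z. wave (g1 x) y z) x z"
      unfolding F_def wave_add by (rule arg_cong[OF wave_commute[symmetric]])
    then show ?thesis
      by (simp add: eq flip: g1(2))
  qed
  \<comment> \<open>F need not have small support; its line sums vanish because those of f2 do and
    those of (A + C) g1 telescope.\<close>
  have F_lines: "(\<Sum>k<2 * a. F y (x + int k) (z + int k)) = 0"
    "(\<Sum>k<2 * a. F y (x + int k) (z - int k)) = 0" for x y z
    using F2(1,2) wave_row_sum[OF per3_slice(2)[OF g1(1)]] by (simp_all add: F_def sum.distrib)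
  obtain y0 where y0: "even y0" "\<And>x z. f2 x y0 z = 0"
    using F2(3)[of 0] by auto
  obtain y1 where y1: "odd y1" "\<And>x z. f2 x y1 z = 0"
    using F2(3)[of 1] by auto
  obtain g2 where g2: "per3 (2 * a) g2" "\<And>y x z. F y x z = wave (g2 y) x z"
    "(\<forall>y x z. wave (\<lambda>y z. F y x z) y z = 0) \<longrightarrow> (\<forall>y x z. wave (\<lambda>y z. g2 y x z) y z = 0)"
  \<comment> \<open>Since (B + C) F = 0, the second function is taken to be 0. On the planes y0 and
    y1, where f2 vanishes, F is the boundary of a slice of g1.\<close>
  proof (rule sweep_to_wave[of a F "\<lambda>x y z. 0", OF \<open>a \<ge> 2\<close> per_F _ _ F_lines
        y0(1) per3_slice(2)[OF g1(1)] _ y1(1) per3_slice(2)[OF g1(1)]])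
    show "per3 (2 * a) (\<lambda>x y z. 0 :: bit)"
      by (simp add: per3_def)
    show "wave (\<lambda>x z. F x y z) x z = wave (\<lambda>y z. 0) y z" for x y z
      unfolding F_wave by (simp add: wave_def)
    show "F y0 x z = wave (\<lambda>x z. g1 x y0 z) x z" "F y1 x z = wave (\<lambda>x z. g1 x y1 z) x z" for x z
      by (simp_all add: F_def y0 y1)
  qed blast
  show thesis
  proof (rule that[of "\<lambda>x y z. g1 x y z + g2 y x z"])
    show "per3 (2 * a) (\<lambda>x y z. g1 x y z + g2 y x z)"
      by (rule per3_add[OF g1(1) per_swap[OF g2(1)]])
    show "f1 x y z = wave (\<lambda>y z. g1 x y z + g2 y x z) y z" for x y z
      by (simp add: wave_add g1(2) g2(3)[rule_format, OF F_wave])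
    show "f2 x y z = wave (\<lambda>x z. g1 x y z + g2 y x z) x z" for x y z
      using g2(2)[of y x z, symmetric] by (simp add: wave_add F_def ac_simps)
  qed
qed

section \<open>Pauli operators as periodic functions\<close>

lemmas bit_ac = add.assoc[where ?'a = bit] add.commute[where ?'a = bit] add.left_commute[where ?'a = bit]

text \<open>The symplectic form of single-qubit Paulis over F_2, which turns \<open>pmul\<close>
  into addition.\<close>

definition omega :: "pauli \<Rightarrow> pauli \<Rightarrow> bit" where
  "omega p q = of_bool (anticomm1 p q)"

lemma omega_simps [simp]:
  "omega PI p = 0" "omega p PI = 0" "omega p p = 0"
  "omega PX PY = 1" "omega PX PZ = 1" "omega PY PX = 1" "omega PY PZ = 1"
  "omega PZ PX = 1" "omega PZ PY = 1"
  by (simp_all add: omega_def anticomm1_def)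

lemma omega_sym: "omega p q = omega q p"
  by (auto simp: omega_def anticomm1_def)

lemma omega_pmul_left [simp]: "omega (pmul p q) r = omega p r + omega q r"
  by (cases p; cases q; cases r) simp_all

lemma omega_pmul_right [simp]: "omega r (pmul p q) = omega r p + omega r q"
  by (simp add: omega_sym[of r])

lemma omega_PZ: "omega p PZ = omega p PX + omega p PY"
  by (cases p) simp_all

lemma pauli_eqI:
  assumes "omega p PX = omega q PX" "omega p PY = omega q PY"
  shows "p = q"
  using assms by (cases p; cases q) simp_all

lemma omega_single: "omega (single q p r) t = of_bool (r = q) * omega p t"
  by (simp add: single_def)

lemma stab_gen_bits:
  "omega (stab_gen a b c s q) PX = of_bool (q = shift a b c s (0, 1, 0))
     + of_bool (q = shift a b c s (0, -1, 0)) + of_bool (q = shift a b c s (0, 0, 1))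
     + of_bool (q = shift a b c s (0, 0, -1))"
  "omega (stab_gen a b c s q) PY = of_bool (q = shift a b c s (1, 0, 0))
     + of_bool (q = shift a b c s (-1, 0, 0)) + of_bool (q = shift a b c s (0, 0, 1))
     + of_bool (q = shift a b c s (0, 0, -1))"
  by (simp_all add: stab_gen_def opmul_def omega_single add.assoc del: shift.simps)

lemma finite_latA: "finite (latA a b c)"
proof (rule finite_subset)
  show "latA a b c \<subseteq> {0..<2 * int a} \<times> {0..<2 * int b} \<times> {0..<2 * int c}"
    by (auto simp: latA_def)
qed simp

lemma finite_latD: "finite (latD a b c)"
  by (rule finite_subset[OF _ finite_latA[of a b c]]) (auto simp: latD_def)

definition pairing :: "nat \<Rightarrow> pop \<Rightarrow> pop \<Rightarrow> bit" where
  "pairing a P Q = (\<Sum>q\<in>latD a a a. omega (P q) (Q q))"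

lemma of_nat_bit: "of_nat n = (of_bool (odd n) :: bit)"
  by (induction n) simp_all

lemma commutes_iff_pairing: "commutes a a a P Q \<longleftrightarrow> pairing a P Q = 0"
proof -
  have "pairing a P Q = of_nat (card {q \<in> latD a a a. anticomm1 (P q) (Q q)})"
    using finite_latD[of a a a] by (simp add: pairing_def omega_def sum_of_bool_eq Int_def)
  then show ?thesis
    by (simp add: commutes_def of_nat_bit)
qed

lemma pairing_opmul_left: "pairing a (opmul P Q) R = pairing a P R + pairing a Q R"
  by (simp add: pairing_def opmul_def sum.distrib)

lemma pairing_opmul_right: "pairing a R (opmul P Q) = pairing a R P + pairing a R Q"
  by (simp add: pairing_def opmul_def sum.distrib)

lemma pairing_sym: "pairing a P Q = pairing a Q P"
  unfolding pairing_def by (intro sum.cong refl omega_sym)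

lemma pairing_single:
  assumes "q \<in> latD a a a"
  shows "pairing a P (single q p) = omega (P q) p"
proof -
  have "pairing a P (single q p) = (\<Sum>r\<in>latD a a a. if r = q then omega (P q) p else 0)"
    unfolding pairing_def single_def by (intro sum.cong) auto
  then show ?thesis
    using assms by (simp add: finite_latD)
qed

text \<open>Names points by unreduced integer coordinates, so that shifts become plain addition and
  operators become periodic functions on Z^3.\<close>

definition wrap :: "nat \<Rightarrow> int \<Rightarrow> int \<Rightarrow> int \<Rightarrow> pt" where
  "wrap a x y z = (x mod (2 * int a), y mod (2 * int a), z mod (2 * int a))"

lemma shift_wrap [simp]: "shift a a a (wrap a x y z) (dx, dy, dz) = wrap a (x + dx) (y + dy) (z + dz)"
  by (simp add: wrap_def mod_simps)

lemma wrap_latA: "a > 0 \<Longrightarrow> wrap a x y z \<in> latA a a a"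
  by (simp add: wrap_def latA_def)

lemma wrap_latD_iff: "a > 0 \<Longrightarrow> wrap a x y z \<in> latD a a a \<longleftrightarrow> even (x + y + z)"
  using wrap_latA[of a x y z] by (simp add: wrap_def latD_def dvd_mod_iff)

lemma latA_wrap: "(x, y, z) \<in> latA a a a \<Longrightarrow> wrap a x y z = (x, y, z)"
  by (simp add: wrap_def latA_def)

lemma latA_cases:
  assumes "q \<in> latA a a a"
  obtains x y z where "q = wrap a x y z"
  using latA_wrap assms by (metis prod_cases3)

text \<open>For \<open>PX\<close> and \<open>PY\<close> these are the functions f1 and f2 of the
  preceding sections.\<close>

definition bits :: "nat \<Rightarrow> pop \<Rightarrow> pauli \<Rightarrow> int \<Rightarrow> int \<Rightarrow> int \<Rightarrow> bit" where
  "bits a P p x y z = omega (P (wrap a x y z)) p"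

lemma per3_bits: "per3 (2 * a) (bits a P p)"
  by (simp add: per3_def bits_def wrap_def)

lemma neighbour_parity:
  fixes x y z :: int
  shows "odd (x + y + z) \<Longrightarrow> even (x + 1 + y + z)" "odd (x + y + z) \<Longrightarrow> even (x - 1 + y + z)"
    "odd (x + y + z) \<Longrightarrow> even (x + (y + 1) + z)" "odd (x + y + z) \<Longrightarrow> even (x + (y - 1) + z)"
    "odd (x + y + z) \<Longrightarrow> even (x + y + (z + 1))" "odd (x + y + z) \<Longrightarrow> even (x + y + (z - 1))"
    "even (x + y + z) \<Longrightarrow> odd (x + 1 + y + z)" "even (x + y + z) \<Longrightarrow> odd (x - 1 + y + z)"
    "even (x + y + z) \<Longrightarrow> odd (x + (y + 1) + z)" "even (x + y + z) \<Longrightarrow> odd (x + (y - 1) + z)"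
    "even (x + y + z) \<Longrightarrow> odd (x + y + (z + 1))" "even (x + y + z) \<Longrightarrow> odd (x + y + (z - 1))"
  by presburger+

text \<open>The X factors read f1 at the x neighbours, the Y factors f2 at the y neighbours, and the
  Z factors f1 + f2 at the z neighbours.\<close>

lemma pairing_stab_gen:
  assumes "a > 0" "odd (x + y + z)"
  shows "pairing a P (stab_gen a a a (wrap a x y z))
    = wave (\<lambda>x z. bits a P PX x y z) x z + wave (bits a P PY x) y z"
proof -
  have single: "pairing a P (single (wrap a u v w) p) = bits a P p u v w" if "even (u + v + w)" for u v w p
    using that assms(1) by (simp add: pairing_single wrap_latD_iff bits_def)
  have PZ: "bits a P PZ u v w = bits a P PX u v w + bits a P PY u v w" for u v w
    by (simp add: bits_def omega_PZ)
  show ?thesis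
    unfolding stab_gen_def pairing_opmul_right shift_wrap
    by (simp add: neighbour_parity(1-6)[OF assms(2), THEN single] PZ wave_def bit_ac)
qed

text \<open>At odd points this is commutation with a generator; at even points both sides involve
  only odd points, where P is the identity.\<close>

lemma logical_bits_wave:
  assumes "a > 0" "\<forall>q. q \<notin> latD a a a \<longrightarrow> P q = PI"
    "\<forall>s \<in> latA a a a - latD a a a. commutes a a a P (stab_gen a a a s)"
  shows "wave (\<lambda>x z. bits a P PX x y z) x z = wave (bits a P PY x) y z"
proof (cases "even (x + y + z)")
  case True
  have zero: "bits a P p u v w = 0" if "odd (u + v + w)" for p u v w
    using that assms(1) assms(2)[rule_format, of "wrap a u v w"] by (simp add: bits_def wrap_latD_iff)
  show ?thesis
    by (simp add: wave_def neighbour_parity(7-12)[OF True, THEN zero])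
next
  case False
  then have "pairing a P (stab_gen a a a (wrap a x y z)) = 0"
    using assms(1,3) wrap_latA[of a x y z] wrap_latD_iff[of a x y z]
    by (auto simp flip: commutes_iff_pairing)
  then show ?thesis
    unfolding pairing_stab_gen[OF assms(1) False] bit_add_eq_0_iff .
qed

lemma stab_group_prod:
  assumes "finite T" "T \<subseteq> latA a a a - latD a a a"
  shows "\<exists>Q\<in>stab_group a a a. \<forall>q p. omega (Q q) p = (\<Sum>s\<in>T. omega (stab_gen a a a s q) p)"
  using assms
proof (induction T rule: finite_induct)
  case empty
  show ?case
    by (intro bexI[of _ "\<lambda>_. PI"] stab_group.stab_id) simp
next
  case (insert s T)
  then obtain Q where "Q \<in> stab_group a a a"
    "\<forall>q p. omega (Q q) p = (\<Sum>s\<in>T. omega (stab_gen a a a s q) p)"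
    by auto
  with insert show ?case
    by (intro bexI[of _ "opmul Q (stab_gen a a a s)"] stab_group.stab_step)
      (simp_all add: opmul_def add.commute)
qed

lemma sum_shift:
  assumes "a > 0" "T \<subseteq> latA a a a" "q \<in> latA a a a"
  shows "(\<Sum>s\<in>T. of_bool (q = shift a a a s (dx, dy, dz))) =
    (of_bool (shift a a a q (- dx, - dy, - dz) \<in> T) :: bit)"
proof -
  have "q = shift a a a s (dx, dy, dz) \<longleftrightarrow> s = shift a a a q (- dx, - dy, - dz)" if "s \<in> T" for s
  proof -
    have "s \<in> latA a a a"
      using that assms by auto
    then obtain x y z where s: "s = wrap a x y z"
      by (rule latA_cases)
    obtain u v w where q: "q = wrap a u v w"
      using assms(3) by (rule latA_cases)
    show ?thesis
    proof
      assume q': "q = shift a a a s (dx, dy, dz)"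
      show "s = shift a a a q (- dx, - dy, - dz)"
        unfolding q' s shift_wrap by simp
    next
      assume s': "s = shift a a a q (- dx, - dy, - dz)"
      show "q = shift a a a s (dx, dy, dz)"
        unfolding s' q shift_wrap by simp
    qed
  qed
  then have "(\<Sum>s\<in>T. of_bool (q = shift a a a s (dx, dy, dz)))
      = (\<Sum>s\<in>T. if s = shift a a a q (- dx, - dy, - dz) then 1 else (0 :: bit))"
    by (intro sum.cong) auto
  then show ?thesis
    using finite_subset[OF assms(2) finite_latA] by simp
qed

text \<open>P is the product of the generators at the odd points with g = 1: the X bit of this
  product at q counts the y and z neighbours of q in \<open>T\<close>, the Y bit the x and z
  neighbours.\<close>

lemma stab_group_of_wave:
  assumes "a > 0" and P: "\<forall>q. q \<notin> latD a a a \<longrightarrow> P q = PI" and g: "per3 (2 * a) g"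
    and "\<And>x y z. bits a P PX x y z = wave (g x) y z"
    and "\<And>x y z. bits a P PY x y z = wave (\<lambda>x z. g x y z) x z"
  shows "P \<in> stab_group a a a"
proof -
  define T where "T = {s \<in> latA a a a - latD a a a. \<exists>x y z. s = (x, y, z) \<and> g x y z = 1}"
  have T: "finite T" "T \<subseteq> latA a a a - latD a a a" "T \<subseteq> latA a a a"
    using finite_latA by (auto simp: T_def)
  obtain Q where Q: "Q \<in> stab_group a a a"
    and Q_bits: "\<And>q p. omega (Q q) p = (\<Sum>s\<in>T. omega (stab_gen a a a s q) p)"
    using stab_group_prod[OF T(1,2)] by blast
  have in_T: "of_bool (wrap a x y z \<in> T) = g x y z" if "odd (x + y + z)" for x y z
  proof -
    have "wrap a x y z \<in> T \<longleftrightarrow> g x y z = 1"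
      using assms(1) that per2D(5,6)[OF per3_slice(1)[OF g]] per2D(5)[OF per3_slice(2)[OF g]]
      by (simp add: T_def wrap_latA wrap_latD_iff) (simp add: wrap_def)
    then show ?thesis
      by (cases "g x y z") simp_all
  qed
  have "P q = Q q" for q
  proof (cases "q \<in> latD a a a")
    case True
    then have q: "q \<in> latA a a a"
      by (auto simp: latD_def)
    then obtain x y z where xyz: "q = wrap a x y z"
      by (rule latA_cases)
    have ev: "even (x + y + z)"
      using True assms(1) by (simp add: xyz wrap_latD_iff)
    have shift: "(\<Sum>s\<in>T. of_bool (q = shift a a a s (dx, dy, dz)))
        = (of_bool (wrap a (x - dx) (y - dy) (z - dz) \<in> T) :: bit)" for dx dy dz
      using sum_shift[OF assms(1) T(3) q, of dx dy dz] by (simp add: xyz)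
    show ?thesis
    proof (rule pauli_eqI)
      show "omega (P q) PX = omega (Q q) PX"
        using assms(4)[of x y z]
        by (simp add: Q_bits stab_gen_bits sum.distrib shift bits_def wave_def
            neighbour_parity(7-12)[OF ev, THEN in_T] bit_ac flip: xyz)
      show "omega (P q) PY = omega (Q q) PY"
        using assms(5)[of x y z]
        by (simp add: Q_bits stab_gen_bits sum.distrib shift bits_def wave_def
            neighbour_parity(7-12)[OF ev, THEN in_T] bit_ac flip: xyz)
    qed
  next
    case False
    have "omega (stab_gen a a a s q) p = 0" if "s \<in> T" for s p
    proof -
      have "s \<in> latA a a a"
        using that T by auto
      then obtain x y z where s: "s = wrap a x y z"
        by (rule latA_cases)
      then have odd: "odd (x + y + z)"
        using that T(2) assms(1) by (auto simp: wrap_latD_iff)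
      have neq: "q \<noteq> wrap a u v w" if "even (u + v + w)" for u v w
        using that False assms(1) by (auto simp: wrap_latD_iff)
      have "stab_gen a a a s q = PI"
        by (simp add: s stab_gen_def opmul_def single_def neighbour_parity(1-6)[OF odd, THEN neq])
      then show ?thesis by simp
    qed
    then show ?thesis
      using P[rule_format, OF False] by (intro pauli_eqI) (simp_all add: Q_bits)
  qed
  then show ?thesis
    using Q by (metis ext)
qed

lemma weight_logical_ge:
  assumes "a \<ge> 2" "logical_op a a a P"
  shows "weight a a a P \<ge> 2 * a"
proof (rule ccontr)
  assume "\<not> ?thesis"
  define W where "W = {q \<in> latD a a a. P q \<noteq> PI}"
  have P: "\<forall>q. q \<notin> latD a a a \<longrightarrow> P q = PI"
    "\<forall>s \<in> latA a a a - latD a a a. commutes a a a P (stab_gen a a a s)"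
    using assms(2) by (simp_all add: logical_op_def)
  have "a > 0"
    using assms(1) by simp
  have W: "finite W" "card W < 2 * a"
    using \<open>\<not> _\<close> finite_latD by (simp_all add: W_def weight_def)
  have odd: "bits a P PX x y z = 0 \<and> bits a P PY x y z = 0" if "odd (x + y + z)" for x y z
    using that \<open>a > 0\<close> P(1)[rule_format, of "wrap a x y z"] by (simp add: bits_def wrap_latD_iff)
  have supp: "(x mod (2 * int a), y mod (2 * int a), z mod (2 * int a)) \<in> W"
    if "bits a P PX x y z \<noteq> 0 \<or> bits a P PY x y z \<noteq> 0" for x y z
  proof -
    have "P (wrap a x y z) \<noteq> PI"
      using that by (auto simp: bits_def)
    then have "wrap a x y z \<in> W"
      using P(1)[rule_format, of "wrap a x y z"] by (auto simp: W_def)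
    then show ?thesis
      by (simp add: wrap_def)
  qed
  obtain g where "per3 (2 * a) g" "\<And>x y z. bits a P PX x y z = wave (g x) y z"
    "\<And>x y z. bits a P PY x y z = wave (\<lambda>x z. g x y z) x z"
    using small_support_is_boundary[OF assms(1) per3_bits per3_bits
        logical_bits_wave[OF \<open>a > 0\<close> P] odd W supp] by blast
  from stab_group_of_wave[OF \<open>a > 0\<close> P(1) this] show False
    using assms(2) by (simp add: logical_op_def)
qed

section \<open>Line operators and the distance\<close>

definition x_line :: "nat \<Rightarrow> pop" where
  "x_line a = (\<lambda>(x, y, z). if (x, y, z) \<in> latA a a a \<and> x = 0 \<and> y = z then PX else PI)"

definition y_line :: "nat \<Rightarrow> pop" where
  "y_line a = (\<lambda>(x, y, z). if (x, y, z) \<in> latA a a a \<and> y = 0 \<and> x = z then PY else PI)"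

text \<open>The wave operator kills the indicator of a diagonal line: the neighbours in the positive
  first and the negative second direction lie on a common parallel, and so do the other two.\<close>

lemma pairing_line_stab_gen:
  assumes "a > 0" "s \<in> latA a a a - latD a a a"
  shows "pairing a (x_line a) (stab_gen a a a s) = 0" "pairing a (y_line a) (stab_gen a a a s) = 0"
proof -
  from assms(2) have "s \<in> latA a a a"
    by blast
  then obtain x y z where s: "s = wrap a x y z"
    by (rule latA_cases)
  then have odd: "odd (x + y + z)"
    using assms by (auto simp: wrap_latD_iff)
  have X: "bits a (x_line a) PX u v w = 0"
    "bits a (x_line a) PY u v w = of_bool (u mod (2 * int a) = 0 \<and> 2 * int a dvd v - w)"
    and Y: "bits a (y_line a) PY u v w = 0"
    "bits a (y_line a) PX u v w = of_bool (v mod (2 * int a) = 0 \<and> 2 * int a dvd u - w)" for u v w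
    using wrap_latA[OF assms(1)]
    by (auto simp: bits_def x_line_def y_line_def wrap_def mod_eq_dvd_iff)
  show "pairing a (x_line a) (stab_gen a a a s) = 0"
    unfolding s pairing_stab_gen[OF assms(1) odd]
    by (simp add: wave_def X algebra_simps)
  show "pairing a (y_line a) (stab_gen a a a s) = 0"
    unfolding s pairing_stab_gen[OF assms(1) odd]
    by (simp add: wave_def Y algebra_simps)
qed

text \<open>The lines meet only at the origin, where X and Y anticommute.\<close>

lemma pairing_lines:
  assumes "a > 0"
  shows "pairing a (x_line a) (y_line a) = 1"
proof -
  have "pairing a (x_line a) (y_line a) = (\<Sum>q\<in>latD a a a. if q = (0, 0, 0) then 1 else 0)"
    unfolding pairing_def
    by (intro sum.cong refl) (auto simp: x_line_def y_line_def latD_def split: prod.split)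
  also have "\<dots> = 1"
    using assms by (simp add: finite_latD) (simp add: latD_def latA_def)
  finally show ?thesis .
qed

text \<open>Pairing with the Y-line vanishes on the whole stabilizer group but not on the
  X-line.\<close>

lemma logical_op_x_line:
  assumes "a > 0"
  shows "logical_op a a a (x_line a)"
proof -
  have "pairing a R (y_line a) = 0" if "R \<in> stab_group a a a" for R
    using that
  proof induction
    case stab_id
    show ?case by (simp add: pairing_def)
  next
    case (stab_step P s)
    then show ?case
      using pairing_line_stab_gen(2)[OF assms stab_step(2)]
      by (simp add: pairing_opmul_left pairing_sym[of a "stab_gen a a a s"])
  qed
  then have "x_line a \<notin> stab_group a a a"
    using pairing_lines[OF assms] by force
  then show ?thesis
    using pairing_line_stab_gen(1)[OF assms]
    by (auto simp: logical_op_def commutes_iff_pairing) (auto simp: x_line_def latD_def)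
qed

lemma weight_x_line: "weight a a a (x_line a) = 2 * a"
proof -
  have "{q \<in> latD a a a. x_line a q \<noteq> PI} = (\<lambda>k. (0, k, k)) ` {0..<2 * int a}"
    by (auto simp: x_line_def latD_def latA_def split: if_splits)
  then show ?thesis
    by (simp add: weight_def card_image inj_on_def)
qed

text \<open>Existence is stated as well, since \<open>LEAST\<close> is informative only for a
  predicate that something satisfies.\<close>

theorem theorem4:
  fixes \<alpha> :: nat
  assumes "\<alpha> > 1"
  shows "(\<exists>P. logical_op \<alpha> \<alpha> \<alpha> P) \<and> code_distance \<alpha> \<alpha> \<alpha> = 2 * \<alpha>"
proof
  have line: "logical_op \<alpha> \<alpha> \<alpha> (x_line \<alpha>)"
    using assms by (intro logical_op_x_line) simp
  then show "\<exists>P. logical_op \<alpha> \<alpha> \<alpha> P"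
    by blast
  show "code_distance \<alpha> \<alpha> \<alpha> = 2 * \<alpha>"
    unfolding code_distance_def
  proof (rule Least_equality)
    show "\<exists>P. logical_op \<alpha> \<alpha> \<alpha> P \<and> weight \<alpha> \<alpha> \<alpha> P = 2 * \<alpha>"
      using line weight_x_line by blast
    show "2 * \<alpha> \<le> w" if "\<exists>P. logical_op \<alpha> \<alpha> \<alpha> P \<and> weight \<alpha> \<alpha> \<alpha> P = w" for w
      using that assms weight_logical_ge[of \<alpha>] by auto
  qed
qed

end
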